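(* Let $q\ge1$ and let $A=(a_1,\ldots,a_q)$, $B=(b_1,\ldots,b_q)$ be real vectors with $B\prec^W A$. Then for each real $x<1$ the function $$ \sigma\mapsto{}_{q+1}F_q(\sigma,A;B;x) $$ is log-convex on $[0,\infty)$.
   Context: $B\prec^W A$ means: $0<a_1\le\cdots\le a_q$, $0<b_1\le\cdots\le b_q$, and $\sum_{i=1}^{k}a_i\le\sum_{i=1}^{k}b_i$ for $k=1,\ldots,q$. The generalized hypergeometric function is ${}_{q+1}F_q(\sigma,A;B;z)=\sum_{n=0}^{\infty}\frac{(\sigma)_n(a_1)_n\cdots(a_q)_n}{(b_1)_n\cdots(b_q)_n\,n!}z^n$ for $|z|<1$, extended by analytic continuation to $\mathbb{C}\setminus[1,\infty)$; $(a)_0=1$, $(a)_n=a(a+1)\cdots(a+n-1)$. *)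

theory Defs
  imports "HOL-Complex_Analysis.Complex_Analysis"
begin

(* Both vectors are increasingly ordered, so the partial sums are those of the smallest entries. *)
definition weak_supermajorized :: "real list \<Rightarrow> real list \<Rightarrow> bool" (infix "\<prec>\<^sup>W" 50)
  where "B \<prec>\<^sup>W A \<longleftrightarrow>
    length B = length A \<and>
    sorted A \<and> (\<forall>a\<in>set A. 0 < a) \<and>
    sorted B \<and> (\<forall>b\<in>set B. 0 < b) \<and>
    (\<forall>k\<in>{1..length A}. sum_list (take k A) \<le> sum_list (take k B))"

definition hypergeom_series :: "complex list \<Rightarrow> complex list \<Rightarrow> complex \<Rightarrow> complex"
  where "hypergeom_series as bs z =
    (\<Sum>n. (\<Prod>a\<leftarrow>as. pochhammer a n) / ((\<Prod>b\<leftarrow>bs. pochhammer b n) * fact n) * z ^ n)"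

definition cut_plane :: "complex set"
  where "cut_plane = - (complex_of_real ` {1..})"

(* The analytic continuation of the series from the unit disc to the cut plane. It is meant for
   length as = length bs + 1 and no b in bs a nonpositive integer. The value is determined as soon
   as a continuation exists (hypergeom_eqI); outside the cut plane it is unspecified. *)
definition hypergeom :: "complex list \<Rightarrow> complex list \<Rightarrow> complex \<Rightarrow> complex"
  where "hypergeom as bs z =
    (THE w. \<exists>f. f holomorphic_on cut_plane \<and>
                (\<forall>u\<in>ball 0 1. f u = hypergeom_series as bs u) \<and> w = f z)"

definition log_convex_on :: "real set \<Rightarrow> (real \<Rightarrow> real) \<Rightarrow> bool"
  where "log_convex_on S f \<longleftrightarrow> (\<forall>x\<in>S. 0 < f x) \<and> convex_on S (\<lambda>x. ln (f x))"

lemma open_cut_plane: "open cut_plane"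
proof -
  have "complex_of_real ` {1..} = \<real> \<inter> {z. 1 \<le> Re z}"
    by (auto simp: complex_is_Real_iff complex_eq_iff image_iff intro!: exI[of _ "Re _"] bexI[of _ "Re _"])
  then have "closed (complex_of_real ` {1..})"
    by (auto intro!: closed_Int closed_complex_Reals closed_halfspace_Re_ge)
  then show ?thesis
    by (simp add: cut_plane_def open_Compl)
qed

lemma ball_subset_cut_plane: "ball 0 1 \<subseteq> cut_plane"
  by (auto simp: cut_plane_def)

lemma connected_cut_plane: "connected cut_plane"
proof -
  have "starlike cut_plane"
    unfolding starlike_def
  proof (intro bexI ballI)
    show "0 \<in> cut_plane"
      using ball_subset_cut_plane by auto
    fix z assume z: "z \<in> cut_plane"
    show "closed_segment 0 z \<subseteq> cut_plane"
    proof
      fix w assume "w \<in> closed_segment 0 z"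
      then obtain t where t: "0 \<le> t" "t \<le> 1" "w = t *\<^sub>R z"
        by (auto simp: in_segment)
      show "w \<in> cut_plane"
      proof (rule ccontr)
        assume "w \<notin> cut_plane"
        then obtain r where r: "r \<ge> 1" "w = of_real r"
          by (auto simp: cut_plane_def)
        with t have "t \<noteq> 0" by auto
        with r t have "z = of_real (r / t)" "r / t \<ge> 1"
          by (auto simp: field_simps scaleR_conv_of_real)
        then show False
          using z by (simp add: cut_plane_def del: of_real_divide)
      qed
    qed
  qed
  then show ?thesis
    by (rule starlike_imp_connected)
qed

lemma hypergeom_eqI:
  assumes f: "f holomorphic_on cut_plane"
    and eq: "\<And>u. u \<in> ball 0 1 \<Longrightarrow> f u = hypergeom_series as bs u"
    and z: "z \<in> cut_plane"
  shows "hypergeom as bs z = f z"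
  unfolding hypergeom_def
proof (rule the_equality)
  show "\<exists>g. g holomorphic_on cut_plane \<and>
          (\<forall>u\<in>ball 0 1. g u = hypergeom_series as bs u) \<and> f z = g z"
    using f eq by blast
next
  fix w assume "\<exists>g. g holomorphic_on cut_plane \<and>
          (\<forall>u\<in>ball 0 1. g u = hypergeom_series as bs u) \<and> w = g z"
  then obtain g where g: "g holomorphic_on cut_plane"
    "\<And>u. u \<in> ball 0 1 \<Longrightarrow> g u = hypergeom_series as bs u" "w = g z"
    by blast
  have "g z = f z"
    by (rule analytic_continuation_open[of "ball 0 1" cut_plane g f])
       (use f eq z g ball_subset_cut_plane open_cut_plane connected_cut_plane in auto)
  with g show "w = f z" by simp
qed

end

theory Submission
  imports Defs "HOL-Real_Asymp.Real_Asymp"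
begin

text \<open>
  The sequence \<open>m n = (a\<^sub>1)\<^sub>n \<cdots> (a\<^sub>q)\<^sub>n / ((b\<^sub>1)\<^sub>n \<cdots> (b\<^sub>q)\<^sub>n)\<close> is completely monotone: it is the limit of products
  over \<open>k < N\<close> of normalised ratios \<open>(b\<^sub>1 + k + n) \<cdots> (b\<^sub>q + k + n) / ((a\<^sub>1 + k + n) \<cdots> (a\<^sub>q + k + n))\<close>, and each of
  these factors into elementary completely monotone ratios by Robin Hood transfers turning \<open>A\<close> into \<open>B\<close>.
  Hence \<open>m\<close> is a Hausdorff moment sequence, and the hypergeometric function is the integral of
  \<open>(1 - z t) powr (- \<sigma>)\<close> against the representing probability measure on \<open>[0, 1]\<close>. That measure need not be
  constructed: its standard discrete approximations, with nodes \<open>k / N\<close>, give functions on the cut plane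
  which converge to the series in the disc by Tannery's theorem, and then on the whole cut plane by
  Montel's theorem. Log-convexity in \<open>\<sigma>\<close> passes from \<open>(1 - x t) powr (- \<sigma>)\<close> to the limit.
\<close>


subsection \<open>Completely monotone sequences\<close>

text \<open>This is minus the forward difference: the usual factor \<open>(-1) ^ j\<close> is
  absorbed, so complete monotonicity is plain nonnegativity of the iterates.\<close>

definition bdiff :: "(nat \<Rightarrow> real) \<Rightarrow> nat \<Rightarrow> real"
  where "bdiff f = (\<lambda>n. f n - f (Suc n))"

definition completely_monotone :: "(nat \<Rightarrow> real) \<Rightarrow> bool"
  where "completely_monotone f \<longleftrightarrow> (\<forall>j n. 0 \<le> (bdiff ^^ j) f n)"

lemma bdiff_pow_Suc: "(bdiff ^^ Suc j) f n = (bdiff ^^ j) f n - (bdiff ^^ j) f (Suc n)"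
  by (simp add: bdiff_def)

lemma bdiff_pow_bdiff: "(bdiff ^^ j) (bdiff f) = (bdiff ^^ Suc j) f"
  by (simp add: funpow_swap1)

lemma bdiff_pow_shift: "(bdiff ^^ j) (\<lambda>n. f (n + k)) n = (bdiff ^^ j) f (n + k)"
  by (induction j arbitrary: n) (simp_all add: bdiff_def)

lemma bdiff_pow_add: "(bdiff ^^ j) (\<lambda>n. f n + g n) n = (bdiff ^^ j) f n + (bdiff ^^ j) g n"
  by (induction j arbitrary: n) (simp_all add: bdiff_def)

lemma bdiff_pow_cmult: "(bdiff ^^ j) (\<lambda>n. c * f n) n = c * (bdiff ^^ j) f n"
  by (induction j arbitrary: n) (simp_all add: bdiff_def right_diff_distrib)

lemma completely_monotone_nonneg: "completely_monotone f \<Longrightarrow> 0 \<le> f n"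
  unfolding completely_monotone_def by (drule spec[of _ 0]) simp

lemma completely_monotone_bdiff: "completely_monotone f \<Longrightarrow> completely_monotone (bdiff f)"
  unfolding completely_monotone_def by (simp only: bdiff_pow_bdiff) blast

lemma completely_monotone_shift: "completely_monotone f \<Longrightarrow> completely_monotone (\<lambda>n. f (n + k))"
  unfolding completely_monotone_def by (simp add: bdiff_pow_shift)

lemma completely_monotone_add:
  "completely_monotone f \<Longrightarrow> completely_monotone g \<Longrightarrow> completely_monotone (\<lambda>n. f n + g n)"
  unfolding completely_monotone_def by (simp add: bdiff_pow_add)

lemma completely_monotone_cmult:
  "completely_monotone f \<Longrightarrow> 0 \<le> c \<Longrightarrow> completely_monotone (\<lambda>n. c * f n)"
  unfolding completely_monotone_def by (simp add: bdiff_pow_cmult)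

lemma completely_monotone_const:
  assumes "0 \<le> c" shows "completely_monotone (\<lambda>_. c)"
proof -
  have "(bdiff ^^ j) (\<lambda>_. c) = (\<lambda>_. if j = 0 then c else 0)" for j
    by (induction j) (auto simp: bdiff_def)
  then show ?thesis
    using assms by (simp add: completely_monotone_def)
qed

text \<open>By the Leibniz rule the difference of a product is a sum of two products of completely
  monotone sequences. The induction on the order of the difference therefore ranges over all
  \<open>f\<close> and \<open>g\<close>.\<close>

lemma completely_monotone_mult:
  assumes "completely_monotone f" "completely_monotone g"
  shows "completely_monotone (\<lambda>n. f n * g n)"
proof -
  have "0 \<le> (bdiff ^^ j) (\<lambda>n. f n * g n) n" for j n
    using assms
  proof (induction j arbitrary: f g n)
    case 0
    then show ?case by (simp add: completely_monotone_nonneg)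
  next
    case (Suc j)
    have "bdiff (\<lambda>n. f n * g n) = (\<lambda>n. bdiff f n * g n + f (n + 1) * bdiff g n)"
      by (auto simp: bdiff_def algebra_simps)
    then have "(bdiff ^^ Suc j) (\<lambda>n. f n * g n) n =
        (bdiff ^^ j) (\<lambda>n. bdiff f n * g n) n + (bdiff ^^ j) (\<lambda>n. f (n + 1) * bdiff g n) n"
      by (simp only: bdiff_pow_bdiff[symmetric] bdiff_pow_add)
    also have "\<dots> \<ge> 0"
      by (intro add_nonneg_nonneg Suc.IH Suc.prems completely_monotone_bdiff completely_monotone_shift)
    finally show ?case .
  qed
  then show ?thesis
    by (simp add: completely_monotone_def)
qed

lemma completely_monotone_prod:
  "(\<And>i. i \<in> I \<Longrightarrow> completely_monotone (f i)) \<Longrightarrow> completely_monotone (\<lambda>n. \<Prod>i\<in>I. f i n)"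
  by (induction I rule: infinite_finite_induct)
     (simp_all add: completely_monotone_const completely_monotone_mult)

lemma completely_monotone_limit:
  assumes "\<And>N. completely_monotone (F N)" "\<And>n. (\<lambda>N. F N n) \<longlonglongrightarrow> f n"
  shows "completely_monotone f"
proof -
  have "(\<lambda>N. (bdiff ^^ j) (F N) n) \<longlonglongrightarrow> (bdiff ^^ j) f n" for j n
    by (induction j arbitrary: n) (auto simp: bdiff_def intro!: tendsto_diff assms(2))
  then show ?thesis
    using assms(1) unfolding completely_monotone_def by (blast intro: LIMSEQ_le_const)
qed

section \<open>Elementary completely monotone ratios of linear factors\<close>

lemma completely_monotone_inverse_shift:
  assumes "0 < a" shows "completely_monotone (\<lambda>n. 1 / (a + real n))"
proof -
  \<comment> \<open>The closed form is the Beta integral of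
    \<open>t powr (a + n - 1) * (1 - t) ^ j\<close> over the unit interval. Its induction step is
    \<open>1 / x - 1 / (x + 1 + j) = (j + 1) / (x * (x + 1 + j))\<close> times the common factor
    \<open>fact j / ?P\<close>.\<close>
  have "(bdiff ^^ j) (\<lambda>n. 1 / (a + real n)) n = fact j / pochhammer (a + real n) (Suc j)" for j n
  proof (induction j arbitrary: n)
    case (Suc j)
    let ?x = "a + real n" and ?P = "pochhammer (a + real n + 1) j"
    have x: "?x > 0" "?P > 0" using assms by (auto intro!: pochhammer_pos)
    have P: "pochhammer ?x (Suc j) = ?x * ?P" "pochhammer (?x + 1) (Suc j) = ?P * (?x + 1 + real j)"
        "pochhammer ?x (Suc (Suc j)) = ?x * ?P * (?x + 1 + real j)"
      by (metis pochhammer_rec, metis pochhammer_Suc, metis pochhammer_rec pochhammer_Suc mult.assoc)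
    have "(bdiff ^^ Suc j) (\<lambda>n. 1 / (a + real n)) n = fact j / (?x * ?P) - fact j / (?P * (?x + 1 + real j))"
      unfolding bdiff_pow_Suc Suc.IH by (simp only: P[symmetric]) (simp add: add_ac)
    also have "\<dots> = fact (Suc j) / (?x * ?P * (?x + 1 + real j))"
      using x by (simp add: divide_simps) (simp add: algebra_simps)
    finally show ?case by (simp only: P)
  qed simp
  then show ?thesis
    using assms by (simp add: completely_monotone_def pochhammer_nonneg)
qed

lemma completely_monotone_ratio:
  assumes "0 < a" "a \<le> b"
  shows "completely_monotone (\<lambda>n. (b + real n) / (a + real n))"
proof -
  have "(b + real n) / (a + real n) = 1 + (b - a) * (1 / (a + real n))" for n
    using assms by (simp add: field_simps)
  then show ?thesis
    using assms
    by (simp only:) (intro completely_monotone_add completely_monotone_cmult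
          completely_monotone_inverse_shift completely_monotone_const; simp)
qed

text \<open>Raising \<open>a\<close> to \<open>b\<close> and lowering \<open>c\<close> by the same
  amount keeps the sum of the two entries, so numerator and denominator differ only by the
  nonnegative constant \<open>(b - a) * (c - b)\<close>.\<close>

lemma completely_monotone_transfer:
  assumes "0 < a" "a \<le> b" "b \<le> c"
  shows "completely_monotone (\<lambda>n. ((b + real n) / (a + real n)) * ((c - (b - a) + real n) / (c + real n)))"
proof -
  have "((b + real n) / (a + real n)) * ((c - (b - a) + real n) / (c + real n)) =
      1 + ((b - a) * (c - b)) * ((1 / (a + real n)) * (1 / (c + real n)))" for n
  proof -
    have "a + real n > 0" "c + real n > 0" using assms by auto
    then show ?thesis by (simp add: divide_simps) (simp add: algebra_simps)
  qed
  then show ?thesis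
    using assms
    by (simp only:) (intro completely_monotone_add completely_monotone_cmult completely_monotone_mult
          completely_monotone_inverse_shift completely_monotone_const; simp)
qed

text \<open>The first pair is removed by a Robin Hood transfer from the first later entry \<open>a j \<ge> b 0\<close> to \<open>a 0\<close>;
  the entries in between are dominated termwise, so the partial sum condition survives. Only \<open>b\<close>
  has to be sorted, which is what makes the induction go through.\<close>

lemma completely_monotone_prod_ratio:
  fixes a b :: "nat \<Rightarrow> real"
  assumes "\<And>i. i < q \<Longrightarrow> 0 < a i" and "\<And>i j. i \<le> j \<Longrightarrow> j < q \<Longrightarrow> b i \<le> b j"
    and "\<And>k. k \<le> q \<Longrightarrow> (\<Sum>i<k. a i) \<le> (\<Sum>i<k. b i)"
  shows "completely_monotone (\<lambda>n. \<Prod>i<q. (b i + real n) / (a i + real n))"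
  using assms
proof (induction q arbitrary: a b)
  case 0
  then show ?case by (simp add: completely_monotone_const)
next
  case (Suc q)
  have a0: "a 0 \<le> b 0" using Suc.prems(3)[of 1] by simp
  show ?case
  proof (cases "\<exists>j<q. b 0 \<le> a (Suc j)")
    \<comment> \<open>Every entry of \<open>a\<close> is now at most \<open>b 0\<close>, hence at
      most its partner in \<open>b\<close>, and each factor is completely monotone by
      itself.\<close>
    case False
    then have "a i \<le> b i" if "i < Suc q" for i
      using that a0 Suc.prems(2)[of 0 i] by (cases i) force+
    then show ?thesis
      using Suc.prems(1) by (intro completely_monotone_prod completely_monotone_ratio) auto
  next
    case True
    define j where "j = (LEAST j. j < q \<and> b 0 \<le> a (Suc j))"
    have j: "j < q" "b 0 \<le> a (Suc j)"
      using LeastI_ex[OF True] by (simp_all add: j_def)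
    have less: "a (Suc i) < b 0" if "i < j" for i
      using not_less_Least[of i "\<lambda>j. j < q \<and> b 0 \<le> a (Suc j)"] that j(1) by (auto simp: j_def)
    \<comment> \<open>The amount \<open>d\<close> lifts \<open>a 0\<close> exactly to
      \<open>b 0\<close> at the expense of \<open>a (Suc j)\<close>, and \<open>a'\<close> is the
      tail left for the induction. Its entry at \<open>j\<close> is still at least
      \<open>a 0\<close>, hence positive.\<close>
    define d where "d = b 0 - a 0"
    define a' where "a' i = a (Suc i) - (if i = j then d else 0)" for i
    have "completely_monotone (\<lambda>n. \<Prod>i<q. (b (Suc i) + real n) / (a' i + real n))"
    proof (rule Suc.IH)
      show "0 < a' i" if "i < q" for i
        using that Suc.prems(1)[of "Suc i"] Suc.prems(1)[of 0] j by (auto simp: a'_def d_def)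
      show "b (Suc i) \<le> b (Suc k)" if "i \<le> k" "k < q" for i k
        using that Suc.prems(2) by simp
      show "(\<Sum>i<k. a' i) \<le> (\<Sum>i<k. b (Suc i))" if k: "k \<le> q" for k
      proof (cases "j < k")
        case False
        show ?thesis
        proof (rule sum_mono)
          fix i assume "i \<in> {..<k}"
          then show "a' i \<le> b (Suc i)"
            using less[of i] Suc.prems(2)[of 0 "Suc i"] False k by (auto simp: a'_def)
        qed
      next
        case True
        \<comment> \<open>A tail sum reaching past \<open>j\<close> has lost \<open>d\<close>;
          together with the dropped \<open>a 0\<close> that is a loss of \<open>b 0\<close>, the
          same term that the sum of \<open>b\<close> loses.\<close>
        have "(\<Sum>i<k. a' i) = (\<Sum>i<Suc k. a i) - b 0"
          unfolding a'_def sum_subtractf sum.lessThan_Suc_shift using True by (simp add: d_def)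
        also have "\<dots> \<le> (\<Sum>i<Suc k. b i) - b 0"
          using Suc.prems(3)[of "Suc k"] k by simp
        also have "\<dots> = (\<Sum>i<k. b (Suc i))"
          unfolding sum.lessThan_Suc_shift by simp
        finally show ?thesis .
      qed
    qed
    moreover have "completely_monotone (\<lambda>n. ((b 0 + real n) / (a 0 + real n)) *
        ((a (Suc j) - (b 0 - a 0) + real n) / (a (Suc j) + real n)))"
      using a0 j Suc.prems(1) by (intro completely_monotone_transfer) auto
    ultimately have *: "completely_monotone (\<lambda>n. (((b 0 + real n) / (a 0 + real n)) *
        ((a (Suc j) - (b 0 - a 0) + real n) / (a (Suc j) + real n))) *
        (\<Prod>i<q. (b (Suc i) + real n) / (a' i + real n)))"
      by (rule completely_monotone_mult[rotated])
    have pos: "0 < a (Suc j) - d + real n" for n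
      using j Suc.prems(1)[of 0] by (auto simp: d_def)
    \<comment> \<open>Passing from \<open>a\<close> to \<open>a'\<close> changes only the factor at
      \<open>j\<close>; its correction is the second half of the transfer ratio.\<close>
    have "(\<Prod>i<q. (b (Suc i) + real n) / (a (Suc i) + real n)) =
        (\<Prod>i<q. ((b (Suc i) + real n) / (a' i + real n)) *
          (if i = j then (a (Suc j) - d + real n) / (a (Suc j) + real n) else 1))" for n
      using pos[of n] by (intro prod.cong) (auto simp: a'_def)
    also have "\<dots> n = (\<Prod>i<q. (b (Suc i) + real n) / (a' i + real n)) *
        ((a (Suc j) - d + real n) / (a (Suc j) + real n))" for n
      unfolding prod.distrib using j(1) by (simp add: prod.delta)
    finally show ?thesis
      using * unfolding prod.lessThan_Suc_shift by (simp add: d_def mult_ac)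
  qed
qed

section \<open>From linear ratios to Pochhammer ratios\<close>

lemma tendsto_pochhammer_ratio:
  fixes a b :: real
  shows "(\<lambda>N. pochhammer (b + real N) n / pochhammer (a + real N) n) \<longlonglongrightarrow> 1"
proof -
  have "(\<lambda>N. (b + real N + i) / (a + real N + i)) \<longlonglongrightarrow> 1" for i :: real
    by real_asymp
  then have "(\<lambda>N. \<Prod>i=0..<n. (b + real N + real i) / (a + real N + real i)) \<longlonglongrightarrow> (\<Prod>i=0..<n. 1)"
    by (intro tendsto_prod)
  then show ?thesis
    by (simp add: pochhammer_prod prod_dividef)
qed

text \<open>Splitting \<open>pochhammer b (N + n)\<close> after \<open>n\<close> factors or after
  \<open>N\<close> factors gives the two sides.\<close>

lemma prod_shift_ratio:
  fixes b :: real
  assumes "0 < b"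
  shows "(\<Prod>k<N. (b + real k + real n) / (b + real k)) = pochhammer (b + real N) n / pochhammer b n"
proof -
  have "(\<Prod>k<N. (b + real k + real n) / (b + real k)) = pochhammer (b + real n) N / pochhammer b N"
    by (simp add: pochhammer_prod prod_dividef add_ac atLeast0LessThan)
  moreover have "pochhammer b n * pochhammer (b + real n) N = pochhammer b N * pochhammer (b + real N) n"
    by (metis pochhammer_product' add.commute)
  moreover have "pochhammer b n > 0" "pochhammer b N > 0"
    using assms by (auto intro: pochhammer_pos)
  ultimately show ?thesis
    by (simp add: frac_eq_eq mult.commute)
qed

text \<open>Adding the same \<open>k\<close> to all entries preserves the order of \<open>b\<close>
  and the partial sum inequalities, so the linear ratios at every shift are completely monotone.
  Their normalised product over \<open>k < N\<close> telescopes to the wanted quotient times a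
  correction that tends to 1.\<close>

lemma completely_monotone_pochhammer_ratio:
  fixes a b :: "nat \<Rightarrow> real"
  assumes a: "\<And>i. i < q \<Longrightarrow> 0 < a i" and b: "\<And>i j. i \<le> j \<Longrightarrow> j < q \<Longrightarrow> b i \<le> b j"
    and le: "\<And>k. k \<le> q \<Longrightarrow> (\<Sum>i<k. a i) \<le> (\<Sum>i<k. b i)"
  shows "completely_monotone (\<lambda>n. \<Prod>i<q. pochhammer (a i) n / pochhammer (b i) n)"
proof (rule completely_monotone_limit)
  have bpos: "0 < b i" if "i < q" for i
    using a[of 0] b[of 0 i] le[of 1] that by auto
  \<comment> \<open>Scaling by \<open>c k\<close> makes the factor at shift \<open>k\<close> equal
    to 1 at \<open>n = 0\<close>.\<close>
  define c where "c k = (\<Prod>i<q. (a i + real k) / (b i + real k))" for k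
  have c: "0 \<le> c k" for k
    unfolding c_def using a bpos by (intro prod_nonneg divide_nonneg_nonneg ballI) (simp_all add: less_imp_le)
  let ?F = "\<lambda>N n. \<Prod>k<N. c k * (\<Prod>i<q. (b i + real k + real n) / (a i + real k + real n))"
  show "completely_monotone (?F N)" for N
    using a b le by (intro completely_monotone_prod completely_monotone_cmult c
        completely_monotone_prod_ratio) (auto simp: sum.distrib add_pos_nonneg)
  fix n
  have "?F N n = (\<Prod>i<q. pochhammer (a i) n / pochhammer (b i) n *
      (pochhammer (b i + real N) n / pochhammer (a i + real N) n))" for N
  proof -
    have "?F N n = (\<Prod>i<q. \<Prod>k<N. ((b i + real k + real n) / (b i + real k)) / ((a i + real k + real n) / (a i + real k)))"
      unfolding c_def prod.distrib[symmetric] by (subst prod.swap) (simp add: mult_ac)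
    also have "\<dots> = (\<Prod>i<q. pochhammer (a i) n / pochhammer (b i) n *
      (pochhammer (b i + real N) n / pochhammer (a i + real N) n))"
    proof (rule prod.cong)
      fix i assume "i \<in> {..<q}"
      then have "a i > 0" "b i > 0" using a bpos by auto
      moreover have "(\<Prod>k<N. ((b i + real k + real n) / (b i + real k)) / ((a i + real k + real n) / (a i + real k))) =
          (\<Prod>k<N. (b i + real k + real n) / (b i + real k)) / (\<Prod>k<N. (a i + real k + real n) / (a i + real k))"
        by (rule prod_dividef)
      ultimately show "(\<Prod>k<N. ((b i + real k + real n) / (b i + real k)) / ((a i + real k + real n) / (a i + real k))) =
          pochhammer (a i) n / pochhammer (b i) n * (pochhammer (b i + real N) n / pochhammer (a i + real N) n)"
        by (simp only: prod_shift_ratio) (simp add: field_simps)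
    qed simp
    finally show ?thesis .
  qed
  moreover have "(\<lambda>N. \<Prod>i<q. pochhammer (a i) n / pochhammer (b i) n *
      (pochhammer (b i + real N) n / pochhammer (a i + real N) n))
      \<longlonglongrightarrow> (\<Prod>i<q. pochhammer (a i) n / pochhammer (b i) n * 1)"
    by (intro tendsto_prod tendsto_mult tendsto_const tendsto_pochhammer_ratio)
  ultimately show "(\<lambda>N. ?F N n) \<longlonglongrightarrow> (\<Prod>i<q. pochhammer (a i) n / pochhammer (b i) n)"
    by simp
qed

subsection \<open>Discrete moment representation\<close>

text \<open>If \<open>m\<close> is the moment sequence of a measure on the unit interval, this is
  the integral of the Bernstein polynomial \<open>(N choose k) * t ^ k * (1 - t) ^ (N - k)\<close>.
  It serves as the mass at the node \<open>k / N\<close>.\<close>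

definition hausdorff_weight :: "(nat \<Rightarrow> real) \<Rightarrow> nat \<Rightarrow> nat \<Rightarrow> real"
  where "hausdorff_weight m N k = real (N choose k) * (bdiff ^^ (N - k)) m k"

lemma hausdorff_weight_nonneg: "completely_monotone m \<Longrightarrow> 0 \<le> hausdorff_weight m N k"
  by (simp add: hausdorff_weight_def completely_monotone_def)

text \<open>With \<open>S\<close> the shift, \<open>bdiff\<close> is \<open>1 - S\<close>, and this
  is the binomial expansion of \<open>(S + (1 - S)) ^ N = 1\<close>. In the induction Pascal's rule
  splits the sum into one of order \<open>N\<close> for \<open>bdiff f\<close> and one for the
  shifted \<open>f\<close>.\<close>

lemma sum_binomial_bdiff: "(\<Sum>k\<le>N. real (N choose k) * (bdiff ^^ (N - k)) f (k + n)) = f n"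
proof (induction N arbitrary: f n)
  case (Suc N)
  let ?D = "\<lambda>j. (bdiff ^^ j) f"
  have "(\<Sum>k\<le>Suc N. real (Suc N choose k) * ?D (Suc N - k) (k + n)) =
      ?D (Suc N) n + (\<Sum>k\<le>N. real (N choose Suc k) * ?D (N - k) (Suc k + n))
      + (\<Sum>k\<le>N. real (N choose k) * ?D (N - k) (Suc k + n))"
    unfolding sum.atMost_Suc_shift by (simp add: sum.distrib[symmetric] algebra_simps del: funpow.simps)
  also have "?D (Suc N) n + (\<Sum>k\<le>N. real (N choose Suc k) * ?D (N - k) (Suc k + n)) =
      (\<Sum>k\<le>Suc N. real (N choose k) * ?D (Suc N - k) (k + n))"
    unfolding sum.atMost_Suc_shift by (simp del: funpow.simps)
  also have "\<dots> = (\<Sum>k\<le>N. real (N choose k) * (bdiff ^^ (N - k)) (bdiff f) (k + n))"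
    by (simp add: Suc_diff_le bdiff_pow_bdiff del: funpow.simps)
  also have "\<dots> = bdiff f n" by (rule Suc.IH)
  also have "(\<Sum>k\<le>N. real (N choose k) * ?D (N - k) (Suc k + n)) = f (Suc n)"
    using Suc.IH[of f "Suc n"] by simp
  finally show ?case by (simp add: bdiff_def)
qed simp

lemma sum_hausdorff_weight: "(\<Sum>k\<le>N. hausdorff_weight m N k) = m 0"
  using sum_binomial_bdiff[of N m 0] by (simp add: hausdorff_weight_def)

text \<open>Rewriting \<open>(N choose k) * (k choose j)\<close> as
  \<open>(N choose j) * ((N - j) choose (k - j))\<close> leaves the preceding binomial identity of
  order \<open>N - j\<close> at index \<open>j\<close>.\<close>

lemma sum_hausdorff_weight_binomial:
  assumes "j \<le> N"
  shows "(\<Sum>k\<le>N. hausdorff_weight m N k * real (k choose j)) = real (N choose j) * m j"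
proof -
  have "(\<Sum>k\<le>N. hausdorff_weight m N k * real (k choose j)) = (\<Sum>k=j..N. hausdorff_weight m N k * real (k choose j))"
    by (rule sum.mono_neutral_right) (auto simp: binomial_eq_0)
  also have "\<dots> = (\<Sum>k=j..N. real ((N choose j) * ((N - j) choose (k - j))) * (bdiff ^^ (N - k)) m k)"
  proof (rule sum.cong)
    fix k assume k: "k \<in> {j..N}"
    have "hausdorff_weight m N k * real (k choose j) = real ((N choose k) * (k choose j)) * (bdiff ^^ (N - k)) m k"
      by (simp add: hausdorff_weight_def)
    also have "(N choose k) * (k choose j) = (N choose j) * ((N - j) choose (k - j))"
      using k by (intro choose_mult) auto
    finally show "hausdorff_weight m N k * real (k choose j) =
        real ((N choose j) * ((N - j) choose (k - j))) * (bdiff ^^ (N - k)) m k" .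
  qed simp
  also have "\<dots> = (\<Sum>k\<le>N - j. real ((N choose j) * ((N - j) choose k)) * (bdiff ^^ (N - j - k)) m (k + j))"
    using assms by (intro sum.reindex_bij_witness[of _ "\<lambda>k. k + j" "\<lambda>k. k - j"]) auto
  also have "\<dots> = real (N choose j) * (\<Sum>k\<le>N - j. real ((N - j) choose k) * (bdiff ^^ (N - j - k)) m (k + j))"
    by (simp add: sum_distrib_left mult.assoc)
  also have "(\<Sum>k\<le>N - j. real ((N - j) choose k) * (bdiff ^^ (N - j - k)) m (k + j)) = m j"
    by (rule sum_binomial_bdiff)
  finally show ?thesis
    .
qed

text \<open>Both quantities are products of \<open>j\<close> factors and are compared factor by
  factor. The bound is uniform in \<open>k\<close> and vanishes as \<open>N\<close> grows.\<close>

lemma power_binomial_ratio_bound: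
  assumes "2 * j \<le> N" "0 < N" "k \<le> N"
  shows "\<bar>(real k / real N) ^ j - real (k choose j) / real (N choose j)\<bar> \<le> real j * real j / (real N - real j)"
proof (cases "j = 0")
  case False
  have 1: "real (k choose j) / real (N choose j) = (\<Prod>i=0..<j. (real k - real i) / (real N - real i))"
    by (simp add: binomial_gbinomial gbinomial_prod_rev prod_dividef)
  have 2: "(real k / real N) ^ j = (\<Prod>i=0..<j. real k / real N)" by simp
  \<comment> \<open>The comparison needs factors of absolute value at most 1. For
    \<open>k < i\<close> the factor \<open>(k - i) / (N - i)\<close> is negative, and
    \<open>2 * j \<le> N\<close> gives \<open>i - k \<le> N - i\<close>.\<close>
  have "norm ((\<Prod>i=0..<j. real k / real N) - (\<Prod>i=0..<j. (real k - real i) / (real N - real i)))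
      \<le> (\<Sum>i=0..<j. norm (real k / real N - (real k - real i) / (real N - real i)))"
    using assms by (intro norm_prod_diff) (auto simp: abs_le_iff divide_simps)
  also have "\<dots> \<le> (\<Sum>i=0..<j. real j / (real N - real j))"
  proof (rule sum_mono)
    fix i assume i: "i \<in> {0..<j}"
    have "real k / real N - (real k - real i) / (real N - real i) = (real i / (real N - real i)) * ((real N - real k) / real N)"
      using i assms by (simp add: divide_simps) (simp add: algebra_simps)
    also have "norm \<dots> \<le> (real i / (real N - real i)) * 1"
      unfolding norm_mult using i assms by (intro mult_mono) (auto simp: divide_simps)
    also have "\<dots> \<le> real j / (real N - real j)"
      using i assms by (simp, intro frac_le) auto
    finally show "norm (real k / real N - (real k - real i) / (real N - real i)) \<le> real j / (real N - real j)" .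
  qed
  finally show ?thesis
    unfolding 1 2 by simp
qed simp

text \<open>The binomial moments are exact at finite \<open>N\<close>; replacing them by power
  moments costs at most the total mass \<open>m 0\<close> times the uniform bound above.\<close>

lemma hausdorff_weight_moment_tendsto:
  assumes m: "completely_monotone m"
  shows "(\<lambda>N. \<Sum>k\<le>N. hausdorff_weight m N k * (real k / real N) ^ j) \<longlonglongrightarrow> m j"
proof (rule LIM_zero_cancel, rule Lim_null_comparison)
  let ?w = "hausdorff_weight m"
  show "\<forall>\<^sub>F N in sequentially. norm ((\<Sum>k\<le>N. ?w N k * (real k / real N) ^ j) - m j)
      \<le> m 0 * (real j * real j / (real N - real j))"
    using eventually_ge_at_top[of "2 * j + 1"]
  proof eventually_elim
    case (elim N)
    have "m j = (\<Sum>k\<le>N. ?w N k * (real (k choose j) / real (N choose j)))"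
      using sum_hausdorff_weight_binomial[of j N m] elim
      by (simp add: sum_divide_distrib[symmetric] field_simps)
    then have "norm ((\<Sum>k\<le>N. ?w N k * (real k / real N) ^ j) - m j) =
        \<bar>\<Sum>k\<le>N. ?w N k * ((real k / real N) ^ j - real (k choose j) / real (N choose j))\<bar>"
      by (simp add: sum_subtractf right_diff_distrib)
    also have "\<dots> \<le> (\<Sum>k\<le>N. ?w N k * (real j * real j / (real N - real j)))"
      using elim hausdorff_weight_nonneg[OF m]
      by (intro order.trans[OF sum_abs] sum_mono) (simp only: abs_mult abs_of_nonneg, intro mult_left_mono power_binomial_ratio_bound; simp)
    also have "\<dots> = m 0 * (real j * real j / (real N - real j))"
      by (simp only: sum_distrib_right[symmetric] sum_hausdorff_weight)
    finally show ?case .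
  qed
  show "(\<lambda>N. m 0 * (real j * real j / (real N - real j))) \<longlonglongrightarrow> 0"
    by real_asymp
qed


subsection \<open>Analytic continuation by discrete moment integrals\<close>

lemma pochhammer_series_sums:
  fixes z :: complex
  assumes "norm z < 1"
  shows "(\<lambda>n. of_real (pochhammer \<sigma> n / fact n) * z ^ n) sums (1 - z) powr (- of_real \<sigma>)"
proof -
  have "(\<lambda>n. (- of_real \<sigma> gchoose n) * (- z) ^ n) sums (1 + - z) powr (- of_real \<sigma>)"
    using assms by (intro gen_binomial_complex) simp
  moreover have "(- of_real \<sigma> gchoose n) * (- z) ^ n = of_real (pochhammer \<sigma> n / fact n) * z ^ n" for n
    by (simp add: gbinomial_pochhammer pochhammer_of_real power_minus[of z] mult_ac)
  ultimately show ?thesis by simp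
qed

text \<open>A value \<open>s \<le> 0\<close> would force \<open>z = (1 - s) / t\<close>, a point of
  the removed ray. Hence the principal power is holomorphic in \<open>z\<close> at every node
  \<open>t\<close>.\<close>

lemma one_minus_mult_cut_plane:
  assumes "z \<in> cut_plane" "t \<in> {0..1}"
  shows "1 - z * of_real t \<notin> \<real>\<^sub>\<le>\<^sub>0"
proof
  assume "1 - z * of_real t \<in> \<real>\<^sub>\<le>\<^sub>0"
  then obtain s where s: "s \<le> 0" "1 - z * of_real t = of_real s"
    by (auto elim!: nonpos_Reals_cases)
  then have zt: "z * of_real t = of_real (1 - s)" by (simp add: algebra_simps)
  with s(1) have "t \<noteq> 0" by auto
  with zt have "z = of_real ((1 - s) / t)" by (simp add: field_simps)
  moreover have "(1 - s) / t \<ge> 1"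
    using assms(2) s(1) \<open>t \<noteq> 0\<close> by (auto simp: field_simps)
  ultimately show False
    using assms(1) by (auto simp: cut_plane_def simp del: of_real_divide)
qed

definition hausdorff_approx :: "(nat \<Rightarrow> real) \<Rightarrow> real \<Rightarrow> nat \<Rightarrow> complex \<Rightarrow> complex"
  where "hausdorff_approx m \<sigma> N z =
    (\<Sum>k\<le>N. of_real (hausdorff_weight m N k) * (1 - z * of_real (real k / real N)) powr (- of_real \<sigma>))"

lemma node_in_unit_interval: "k \<le> N \<Longrightarrow> real k / real N \<in> {0..1}"
  \<comment> \<open>For \<open>N = 0\<close> division by zero puts the only node at 0.\<close>
  by (cases "N = 0") auto

lemma holomorphic_on_hausdorff_approx: "hausdorff_approx m \<sigma> N holomorphic_on cut_plane"
  unfolding hausdorff_approx_def [abs_def]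
proof (intro holomorphic_intros)
  fix z k assume "z \<in> cut_plane" "k \<in> {..N}"
  then show "1 - z * of_real (real k / real N) \<notin> \<real>\<^sub>\<le>\<^sub>0"
    by (intro one_minus_mult_cut_plane node_in_unit_interval) auto
qed

text \<open>The kernel is continuous on the compact set \<open>K \<times> {0..1}\<close>, and the
  nonnegative weights have total mass \<open>m 0\<close> for every \<open>N\<close>. Uniformity in
  \<open>N\<close> is what Montel's theorem asks for.\<close>

lemma hausdorff_approx_bounded:
  assumes m: "completely_monotone m" and K: "compact K" "K \<subseteq> cut_plane"
  shows "\<exists>C. \<forall>N. \<forall>z\<in>K. norm (hausdorff_approx m \<sigma> N z) \<le> C"
proof -
  have "continuous_on (K \<times> {0..1}) (\<lambda>(z, t). (1 - z * of_real t) powr (- of_real \<sigma> :: complex))"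
    unfolding case_prod_unfold
  proof (rule continuous_on_powr_complex)
    have *: "1 - fst p * of_real (snd p) \<notin> \<real>\<^sub>\<le>\<^sub>0" if "p \<in> K \<times> {0..1}" for p :: "complex \<times> real"
      using that K(2) by (intro one_minus_mult_cut_plane) auto
    show "K \<times> {0..1} \<subseteq> {p. Re (1 - fst p * of_real (snd p)) \<ge> 0 \<or> Im (1 - fst p * of_real (snd p)) \<noteq> 0}"
      using * by (auto simp: complex_nonpos_Reals_iff simp del: minus_complex.simps times_complex.simps)
    \<comment> \<open>This case is vacuous, since the base never vanishes on
      \<open>K \<times> {0..1}\<close>.\<close>
    show "0 < Re (- of_real \<sigma>)" if "p \<in> K \<times> {0..1}" "1 - fst p * of_real (snd p) = 0" for p :: "complex \<times> real"
      using *[OF that(1)] that(2) by simp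
  qed (intro continuous_intros)+
  then have "compact ((\<lambda>(z, t). (1 - z * of_real t) powr (- of_real \<sigma> :: complex)) ` (K \<times> {0..1}))"
    by (intro compact_continuous_image compact_Times K) auto
  then obtain C where C: "\<And>z t. z \<in> K \<Longrightarrow> t \<in> {0..1} \<Longrightarrow> norm ((1 - z * of_real t) powr (- of_real \<sigma> :: complex)) \<le> C"
    by (force dest!: compact_imp_bounded simp: bounded_iff)
  have "norm (hausdorff_approx m \<sigma> N z) \<le> m 0 * C" if z: "z \<in> K" for N z
  proof -
    have "norm (hausdorff_approx m \<sigma> N z) \<le> (\<Sum>k\<le>N. hausdorff_weight m N k * C)"
      unfolding hausdorff_approx_def
    proof (rule order.trans[OF norm_sum], rule sum_mono)
      fix k assume "k \<in> {..N}"
      then show "norm (of_real (hausdorff_weight m N k) * (1 - z * of_real (real k / real N)) powr (- of_real \<sigma>))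
          \<le> hausdorff_weight m N k * C"
        unfolding norm_mult norm_of_real using hausdorff_weight_nonneg[OF m]
        by (simp only: abs_of_nonneg) (intro mult_left_mono C z node_in_unit_interval; simp)
    qed
    then show ?thesis
      by (simp only: sum_distrib_right[symmetric] sum_hausdorff_weight)
  qed
  then show ?thesis by blast
qed

text \<open>Expanding the kernel at each node gives the same series with the discrete moment
  \<open>M N n\<close> in place of \<open>m n\<close>. Since \<open>\<sigma>\<close> is nonnegative,
  so are the binomial coefficients, and \<open>m 0\<close> times the binomial series at
  \<open>norm z\<close> is the dominating series for Tannery's theorem.\<close>

lemma hausdorff_approx_tendsto_series:
  assumes m: "completely_monotone m" and \<sigma>: "0 \<le> \<sigma>" and z: "norm z < 1"
  shows "(\<lambda>N. hausdorff_approx m \<sigma> N z) \<longlonglongrightarrow> (\<Sum>n. of_real (pochhammer \<sigma> n / fact n * m n) * z ^ n)"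
proof -
  define M where "M N n = (\<Sum>k\<le>N. hausdorff_weight m N k * (real k / real N) ^ n)" for N n
  let ?p = "\<lambda>n. pochhammer \<sigma> n / fact n"
  have p: "0 \<le> ?p n" for n
    using \<sigma> by (simp add: pochhammer_prod prod_nonneg)
  have M: "\<bar>M N n\<bar> \<le> m 0" for N n
  proof -
    have "\<bar>M N n\<bar> \<le> (\<Sum>k\<le>N. hausdorff_weight m N k * 1)"
      unfolding M_def
    proof (rule order.trans[OF sum_abs], rule sum_mono)
      fix k assume "k \<in> {..N}"
      then show "\<bar>hausdorff_weight m N k * (real k / real N) ^ n\<bar> \<le> hausdorff_weight m N k * 1"
        using hausdorff_weight_nonneg[OF m, of N k] node_in_unit_interval[of k N]
        by (auto simp: abs_mult intro!: mult_left_le power_le_one)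
    qed
    then show ?thesis by (simp add: sum_hausdorff_weight)
  qed
  have approx: "hausdorff_approx m \<sigma> N z = (\<Sum>n. of_real (?p n) * z ^ n * of_real (M N n))" for N
  proof -
    have "(\<lambda>n. \<Sum>k\<le>N. of_real (hausdorff_weight m N k) * (of_real (?p n) * (z * of_real (real k / real N)) ^ n))
        sums hausdorff_approx m \<sigma> N z"
      unfolding hausdorff_approx_def
    proof (intro sums_sum sums_mult pochhammer_series_sums)
      fix k assume "k \<in> {..N}"
      then have "norm (z * of_real (real k / real N)) \<le> norm z * 1"
        unfolding norm_mult using node_in_unit_interval[of k N] by (intro mult_left_mono) (auto simp: norm_divide)
      then show "norm (z * of_real (real k / real N)) < 1" using z by simp
    qed
    moreover have "(\<Sum>k\<le>N. of_real (hausdorff_weight m N k) * (of_real (?p n) * (z * of_real (real k / real N)) ^ n))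
        = of_real (?p n) * z ^ n * of_real (M N n)" for n
      by (simp add: M_def sum_distrib_left power_mult_distrib mult_ac power_divide)
    ultimately show ?thesis
      by (simp add: sums_iff)
  qed
  have "summable (\<lambda>n. complex_of_real (?p n) * of_real (norm z) ^ n)"
    using z by (intro sums_summable[OF pochhammer_series_sums]) simp
  then have "summable (\<lambda>n. complex_of_real (?p n * norm z ^ n))"
    by simp
  then have "summable (\<lambda>n. ?p n * norm z ^ n * m 0)"
    by (intro summable_mult2) (simp only: summable_of_real_iff)
  moreover have "norm (of_real (?p n) * z ^ n * of_real (M N n)) \<le> ?p n * norm z ^ n * m 0" for N n
  proof -
    have "norm (of_real (?p n) * z ^ n * of_real (M N n)) = ?p n * norm z ^ n * \<bar>M N n\<bar>"
      unfolding norm_mult norm_power norm_of_real by (simp only: abs_of_nonneg[OF p])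
    also have "\<dots> \<le> ?p n * norm z ^ n * m 0"
      by (intro mult_left_mono M mult_nonneg_nonneg p) simp
    finally show ?thesis .
  qed
  moreover have "(\<lambda>N. of_real (?p n) * z ^ n * of_real (M N n)) \<longlonglongrightarrow> of_real (?p n) * z ^ n * complex_of_real (m n)" for n
    unfolding M_def by (intro tendsto_intros hausdorff_weight_moment_tendsto m)
  ultimately have "(\<lambda>N. \<Sum>n. of_real (?p n) * z ^ n * of_real (M N n)) \<longlonglongrightarrow> (\<Sum>n. of_real (?p n) * z ^ n * complex_of_real (m n))"
    using tannerys_theorem[of "\<lambda>n N. of_real (?p n) * z ^ n * of_real (M N n)"
        "\<lambda>n. of_real (?p n) * z ^ n * complex_of_real (m n)" sequentially "\<lambda>n. ?p n * norm z ^ n * m 0"]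
    by (simp add: case_prod_unfold)
  then show ?thesis
    by (simp add: approx mult_ac)
qed

section \<open>Extension of the limit from the disc to the cut plane\<close>

text \<open>If convergence failed, \<open>r\<close> could enumerate infinitely many indices that
  stay away from \<open>L\<close>. All values of \<open>X\<close> along \<open>r\<close> are then
  bad, so \<open>s\<close> may be any selection, monotone or not.\<close>

lemma LIMSEQ_subsequenceI:
  fixes X :: "nat \<Rightarrow> 'a::metric_space"
  assumes "\<And>r :: nat \<Rightarrow> nat. strict_mono r \<Longrightarrow> \<exists>s. (\<lambda>n. X (r (s n))) \<longlonglongrightarrow> L"
  shows "X \<longlonglongrightarrow> L"
proof (rule ccontr)
  assume "\<not> X \<longlonglongrightarrow> L"
  then obtain e where e: "e > 0" "\<And>N. \<exists>n\<ge>N. \<not> dist (X n) L < e"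
    by (auto simp: lim_sequentially)
  then have inf: "infinite {n. \<not> dist (X n) L < e}"
    by (auto simp: infinite_nat_iff_unbounded_le)
  obtain s where "(\<lambda>n. X (enumerate {n. \<not> dist (X n) L < e} (s n))) \<longlonglongrightarrow> L"
    using assms strict_mono_enumerate[OF inf] by blast
  then have "\<forall>\<^sub>F n in sequentially. dist (X (enumerate {n. \<not> dist (X n) L < e} (s n))) L < e"
    using e(1) by (rule tendstoD)
  then show False
    using enumerate_in_set[OF inf] by (auto simp: eventually_sequentially)
qed

text \<open>Every subsequential limit from Montel's theorem is holomorphic and equals the series in
  the disc, so it is the analytic continuation. This proves that the continuation exists and that
  all subsequential limits agree.\<close>

lemma hausdorff_approx_tendsto_hypergeom:
  assumes m: "completely_monotone m" and \<sigma>: "0 \<le> \<sigma>" and z: "z \<in> cut_plane"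
    and series: "\<And>u. u \<in> ball 0 1 \<Longrightarrow>
      hypergeom_series as bs u = (\<Sum>n. of_real (pochhammer \<sigma> n / fact n * m n) * u ^ n)"
  shows "(\<lambda>N. hausdorff_approx m \<sigma> N z) \<longlonglongrightarrow> hypergeom as bs z"
proof (rule LIMSEQ_subsequenceI)
  fix r :: "nat \<Rightarrow> nat" assume r: "strict_mono r"
  obtain g s where g: "g holomorphic_on cut_plane" and s: "strict_mono (s :: nat \<Rightarrow> nat)"
    and lim: "\<And>u. u \<in> cut_plane \<Longrightarrow> (\<lambda>n. hausdorff_approx m \<sigma> (r (s n)) u) \<longlonglongrightarrow> g u"
  proof (rule Montel[of cut_plane "range (\<lambda>n. hausdorff_approx m \<sigma> (r n))" "\<lambda>n. hausdorff_approx m \<sigma> (r n)"])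
    show "\<exists>B. \<forall>h\<in>range (\<lambda>n. hausdorff_approx m \<sigma> (r n)). \<forall>z\<in>K. norm (h z) \<le> B"
      if "compact K" "K \<subseteq> cut_plane" for K
      using hausdorff_approx_bounded[OF m that] by blast
  qed (use open_cut_plane holomorphic_on_hausdorff_approx in auto)
  have "g u = hypergeom_series as bs u" if u: "u \<in> ball 0 1" for u
  proof (rule LIMSEQ_unique)
    show "(\<lambda>n. hausdorff_approx m \<sigma> (r (s n)) u) \<longlonglongrightarrow> g u"
      using lim u ball_subset_cut_plane by blast
    show "(\<lambda>n. hausdorff_approx m \<sigma> (r (s n)) u) \<longlonglongrightarrow> hypergeom_series as bs u"
      using LIMSEQ_subseq_LIMSEQ[OF hausdorff_approx_tendsto_series[OF m \<sigma>] strict_mono_o[OF r s]] u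
      by (simp add: series o_def)
  qed
  then have "hypergeom as bs z = g z"
    using g z by (intro hypergeom_eqI)
  then show "\<exists>s. (\<lambda>n. hausdorff_approx m \<sigma> (r (s n)) z) \<longlonglongrightarrow> hypergeom as bs z"
    using lim[OF z] by auto
qed

subsection \<open>Log-convexity\<close>

text \<open>This is Hoelder's inequality for the measures with weights \<open>w N\<close>, carried
  to the limit. The common bound \<open>C\<close> on the bases keeps the limit positive.\<close>

lemma log_convex_on_limit_powr_sum:
  fixes w c :: "nat \<Rightarrow> nat \<Rightarrow> real"
  assumes w: "\<And>N k. 0 \<le> w N k" "\<And>N. (\<Sum>k\<le>N. w N k) = 1"
    and c: "\<And>N k. k \<le> N \<Longrightarrow> 0 < c N k" "\<And>N k. k \<le> N \<Longrightarrow> c N k \<le> C"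
    and lim: "\<And>\<sigma>. 0 \<le> \<sigma> \<Longrightarrow> (\<lambda>N. \<Sum>k\<le>N. w N k * c N k powr (- \<sigma>)) \<longlonglongrightarrow> H \<sigma>"
  shows "log_convex_on {0..} H"
proof -
  have C: "0 < C" using c[of 0 0] by linarith
  have pos: "0 < H \<sigma>" if \<sigma>: "0 \<le> \<sigma>" for \<sigma>
  proof -
    have "C powr (- \<sigma>) \<le> (\<Sum>k\<le>N. w N k * c N k powr (- \<sigma>))" for N
    proof -
      have "C powr (- \<sigma>) = (\<Sum>k\<le>N. w N k * C powr (- \<sigma>))"
        by (simp add: sum_distrib_right[symmetric] w)
      also have "\<dots> \<le> (\<Sum>k\<le>N. w N k * c N k powr (- \<sigma>))"
        using \<sigma> c by (intro sum_mono mult_left_mono w powr_mono2') auto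
      finally show ?thesis .
    qed
    then have "C powr (- \<sigma>) \<le> H \<sigma>"
      using lim[OF \<sigma>] by (intro LIMSEQ_le_const) auto
    then show ?thesis
      using C by (smt (verit) powr_gt_zero)
  qed
  have "convex_on {0..} (\<lambda>\<sigma>. ln (H \<sigma>))"
  proof (rule convex_onI)
    fix t x y :: real assume t: "0 < t" "t < 1" and xy: "x \<in> {0..}" "y \<in> {0..}"
    define s where "s = (1 - t) * x + t * y"
    \<comment> \<open>Here \<open>exp l\<close> is the weighted geometric mean of \<open>H x\<close>
      and \<open>H y\<close>. Normalising by it reduces the claim to a termwise AM-GM inequality
      whose right side, summed, tends to \<open>(1 - t) + t = 1\<close>.\<close>
    define l where "l = (1 - t) * ln (H x) + t * ln (H y)"
    have s: "0 \<le> s" using t xy by (simp add: s_def)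
    have AM_GM: "c N k powr (- s) * exp (- l) \<le>
        (1 - t) * (c N k powr (- x) / H x) + t * (c N k powr (- y) / H y)" if k: "k \<le> N" for N k
    proof -
      define p where "p u = - u * ln (c N k) - ln (H u)" for u
      have p: "exp (p u) = c N k powr (- u) / H u" if "0 \<le> u" for u
        using that c(1)[OF k] pos by (simp add: p_def exp_diff powr_def)
      have "c N k powr (- s) * exp (- l) = exp ((1 - t) * p x + t * p y)"
        using c(1)[OF k] by (simp add: powr_def p_def s_def l_def exp_add[symmetric] algebra_simps)
      also have "\<dots> \<le> (1 - t) * exp (p x) + t * exp (p y)"
        using convex_onD[OF exp_convex, of t "p x" "p y"] t by simp
      finally show ?thesis using p xy by simp
    qed
    have "(\<Sum>k\<le>N. w N k * c N k powr (- s)) * exp (- l) \<le>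
        (1 - t) * ((\<Sum>k\<le>N. w N k * c N k powr (- x)) / H x) + t * ((\<Sum>k\<le>N. w N k * c N k powr (- y)) / H y)" for N
    proof -
      have "(\<Sum>k\<le>N. w N k * c N k powr (- s)) * exp (- l) = (\<Sum>k\<le>N. w N k * (c N k powr (- s) * exp (- l)))"
        by (simp add: sum_distrib_right mult.assoc)
      also have "\<dots> \<le> (\<Sum>k\<le>N. w N k * ((1 - t) * (c N k powr (- x) / H x) + t * (c N k powr (- y) / H y)))"
        by (intro sum_mono mult_left_mono AM_GM w) auto
      also have "\<dots> = (1 - t) * ((\<Sum>k\<le>N. w N k * c N k powr (- x)) / H x) + t * ((\<Sum>k\<le>N. w N k * c N k powr (- y)) / H y)"
        by (simp add: sum_distrib_left sum_divide_distrib sum.distrib distrib_left mult_ac)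
      finally show ?thesis .
    qed
    moreover have "(\<lambda>N. (\<Sum>k\<le>N. w N k * c N k powr (- s)) * exp (- l)) \<longlonglongrightarrow> H s * exp (- l)"
      using s by (intro tendsto_intros lim)
    moreover have "(\<lambda>N. (1 - t) * ((\<Sum>k\<le>N. w N k * c N k powr (- x)) / H x) + t * ((\<Sum>k\<le>N. w N k * c N k powr (- y)) / H y))
        \<longlonglongrightarrow> (1 - t) * (H x / H x) + t * (H y / H y)"
      using xy pos[of x] pos[of y] by (intro tendsto_intros lim) auto
    ultimately have "H s * exp (- l) \<le> (1 - t) * (H x / H x) + t * (H y / H y)"
      by (metis (no_types, lifting) LIMSEQ_le)
    then have "H s \<le> exp l"
      using xy pos[of x] pos[of y] by (simp add: exp_minus field_simps)
    then have "ln (H s) \<le> l"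
      using pos[OF s] by (metis exp_gt_zero ln_exp ln_le_cancel_iff)
    then show "ln (H ((1 - t) *\<^sub>R x + t *\<^sub>R y)) \<le> (1 - t) * ln (H x) + t * ln (H y)"
      by (simp add: s_def l_def)
  qed (rule convex_real_interval)
  then show ?thesis
    using pos by (simp add: log_convex_on_def)
qed

section \<open>Log-convexity of the hypergeometric function in its first parameter\<close>

theorem theorem7:
  fixes A B :: "real list" and q :: nat and x :: real
  assumes "q \<ge> 1" and "length A = q" and "length B = q"
    and "B \<prec>\<^sup>W A"
    and "x < 1"
  shows "(\<forall>\<sigma>\<ge>0. hypergeom (map of_real (\<sigma> # A)) (map of_real B) (of_real x) \<in> \<real>) \<and>
    log_convex_on {0..} (\<lambda>\<sigma>. Re (hypergeom (map of_real (\<sigma> # A)) (map of_real B) (of_real x)))"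
proof -
  define m where "m n = (\<Prod>i<q. pochhammer (A ! i) n / pochhammer (B ! i) n)" for n
  define F where "F \<sigma> = hypergeom (map of_real (\<sigma> # A)) (map of_real B) (of_real x)" for \<sigma>
  define c where "c N k = 1 - x * (real k / real N)" for N k
  define h where "h N \<sigma> = (\<Sum>k\<le>N. hausdorff_weight m N k * c N k powr (- \<sigma>))" for N \<sigma>
  have m: "completely_monotone m"
    unfolding m_def
  proof (rule completely_monotone_pochhammer_ratio)
    \<comment> \<open>The majorization condition starts at \<open>k = 1\<close>, so the empty sum is
      treated separately.\<close>
    show "(\<Sum>i<k. A ! i) \<le> (\<Sum>i<k. B ! i)" if "k \<le> q" for k
      using that assms(2-4)
      by (cases "k = 0") (auto simp: weak_supermajorized_def sum_list_sum_nth atLeast0LessThan)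
  qed (use assms(2-4) in \<open>auto simp: weak_supermajorized_def intro: sorted_nth_mono\<close>)
  have nth: "(\<Prod>a\<leftarrow>map of_real L. pochhammer a n) = complex_of_real (\<Prod>i<length L. pochhammer (L ! i) n)"
    for L n
    by (simp add: prod.list_conv_set_nth atLeast0LessThan pochhammer_of_real)
  have series: "hypergeom_series (map of_real (\<sigma> # A)) (map of_real B) u =
      (\<Sum>n. of_real (pochhammer \<sigma> n / fact n * m n) * u ^ n)" for \<sigma> u
    using nth[where L = A] nth[where L = B] assms(2,3)
    by (simp add: hypergeom_series_def m_def prod_dividef pochhammer_of_real mult_ac)
  have cut: "complex_of_real x \<in> cut_plane"
    using assms(5) by (auto simp: cut_plane_def)
  have c: "0 < c N k" "c N k \<le> 1 + \<bar>x\<bar>" if "k \<le> N" for N k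
  proof -
    define t where "t = real k / real N"
    have t: "0 \<le> t" "t \<le> 1" using node_in_unit_interval[OF that] by (auto simp: t_def)
    have "x * t < 1"
    proof (cases "0 \<le> x")
      case True
      then have "x * t \<le> x" using t by (simp add: mult_left_le)
      then show ?thesis using assms(5) by simp
    next
      case False
      then have "x * t \<le> 0" using t by (simp add: mult_nonpos_nonneg)
      then show ?thesis by simp
    qed
    then show "0 < c N k" by (simp add: c_def t_def)
    have "\<bar>x * t\<bar> \<le> \<bar>x\<bar>" using t by (simp add: abs_mult mult_left_le)
    then have "1 - x * t \<le> 1 + \<bar>x\<bar>" by linarith
    then show "c N k \<le> 1 + \<bar>x\<bar>" by (simp add: c_def t_def)
  qed
  \<comment> \<open>At real \<open>x < 1\<close> all bases are positive, so the complex powers are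
    real powers.\<close>
  have "hausdorff_approx m \<sigma> N (of_real x) = of_real (h N \<sigma>)" for \<sigma> N
    unfolding hausdorff_approx_def h_def of_real_sum
  proof (rule sum.cong)
    fix k assume "k \<in> {..N}"
    then have "0 \<le> c N k" using c by (simp add: less_imp_le)
    then show "of_real (hausdorff_weight m N k) * (1 - of_real x * of_real (real k / real N)) powr (- of_real \<sigma>) =
        complex_of_real (hausdorff_weight m N k * c N k powr (- \<sigma>))"
      using powr_of_real[of "c N k" "- \<sigma>"] by (simp add: c_def)
  qed simp
  then have lim: "(\<lambda>N. complex_of_real (h N \<sigma>)) \<longlonglongrightarrow> F \<sigma>" if "0 \<le> \<sigma>" for \<sigma>
    using hausdorff_approx_tendsto_hypergeom[OF m that cut series] by (simp add: F_def)
  have "F \<sigma> \<in> \<real>" if "0 \<le> \<sigma>" for \<sigma>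
    by (rule closed_sequentially[OF closed_complex_Reals _ lim[OF that]]) simp
  moreover have "log_convex_on {0..} (\<lambda>\<sigma>. Re (F \<sigma>))"
  proof (rule log_convex_on_limit_powr_sum)
    \<comment> \<open>The total mass is \<open>m 0\<close>, a product of Pochhammer symbols of order
      0.\<close>
    show "(\<Sum>k\<le>N. hausdorff_weight m N k) = 1" for N
      by (simp add: sum_hausdorff_weight m_def)
    show "(\<lambda>N. \<Sum>k\<le>N. hausdorff_weight m N k * c N k powr (- \<sigma>)) \<longlonglongrightarrow> Re (F \<sigma>)" if "0 \<le> \<sigma>" for \<sigma>
      using tendsto_Re[OF lim[OF that]] by (simp add: h_def)
  qed (use c hausdorff_weight_nonneg[OF m] in auto)
  ultimately show ?thesis
    by (simp add: F_def)
qed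

end
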